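(* Let $\mathcal H$ be a separable Hilbert space, let $K\in\mathcal L(\mathcal H)$ be an idempotent operator ($K^2=K$) with closed range, and let $\mathcal W_v=\{(\mathcal W_i,v_i)\}_{i\in I}$ be a $K$-fusion frame for $\mathcal H$ such that $K^{\dagger}\,\overline{K(\mathcal W_i)}\subset \mathcal W_i$ for all $i\in I$. Then $\{(K\mathcal W_i,v_i)\}_{i\in I}$ is a $K$-fusion frame for $\mathcal H$.
   Context: $\mathcal L(\mathcal H)$ is the space of bounded linear operators on $\mathcal H$. The index set $I$ is finite or countable. For a closed subspace $\mathcal W$, $P_{\mathcal W}$ denotes the orthogonal projection onto $\mathcal W$. For an operator $K$ with closed range, $K^{\dagger}$ denotes its Moore–Penrose pseudo-inverse. $K\mathcal W_i=K(\mathcal W_i)$ is the image of $\mathcal W_i$ under $K$. A weighted collection of closed subspaces $\mathcal W_v=\{(\mathcal W_i,v_i)\}_{i\in I}$ consists of closed subspaces $\mathcal W_i$ of $\mathcal H$ and real scalars $v_i$. For $K\in\mathcal L(\mathcal H)$, such a collection is a $K$-fusion frame for $\mathcal H$ if there exist constants $A,B>0$ such that $A\|K^*f\|^2\le\sum_{i\in I}v_i^2\|P_{\mathcal W_i}f\|^2\le B\|f\|^2$ for all $f\in\mathcal H$. (In particular, being a $K$-fusion frame includes that the members of the collection are closed subspaces.) *)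

theory Defs
  imports "HOL-Analysis.Analysis"
begin

text \<open>The scalars are the real or the complex numbers. Both are covered at once by the
  class of real normed fields with a conjugation \<open>conjg\<close> satisfying \<open>x * conjg x = |x|^2\<close>; up to
  isomorphism (Gelfand--Mazur) these are the only two fields in the class.\<close>

class rc_field = real_normed_field +
  fixes conjg :: "'a \<Rightarrow> 'a"
  assumes conjg_add: "conjg (x + y) = conjg x + conjg y"
    and conjg_mult: "conjg (x * y) = conjg x * conjg y"
    and mult_conjg: "x * conjg x = ((norm x)\<^sup>2) *\<^sub>R 1"

instantiation real :: rc_field
begin
definition conjg_real :: "real \<Rightarrow> real" where "conjg_real x = x"
instance by standard (auto simp: conjg_real_def power2_eq_square)
end

instantiation complex :: rc_field
begin
definition conjg_complex :: "complex \<Rightarrow> complex" where "conjg_complex = cnj"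
instance by standard (auto simp: conjg_complex_def complex_norm_square[symmetric] scaleR_conv_of_real)
end

text \<open>Completeness comes from the sort \<open>banach\<close>, whose norm is required to be the one induced
  by the inner product \<open>ip\<close> (linear in the first argument).\<close>

locale hilbert_space = vector_space scale
  for scale :: "'k::rc_field \<Rightarrow> 'a::banach \<Rightarrow> 'a" +
  fixes ip :: "'a \<Rightarrow> 'a \<Rightarrow> 'k"
  assumes scale_of_real: "scale (of_real r) x = r *\<^sub>R x"
    and ip_add_left: "ip (x + y) z = ip x z + ip y z"
    and ip_scale_left: "ip (scale c x) y = c * ip x y"
    and ip_commute: "ip x y = conjg (ip y x)"
    and ip_self: "ip x x = of_real ((norm x)\<^sup>2)"
begin

definition bounded_op :: "('a \<Rightarrow> 'a) \<Rightarrow> bool" where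
  "bounded_op T \<longleftrightarrow> bounded_linear T \<and> (\<forall>c x. T (scale c x) = scale c (T x))"

definition adj :: "('a \<Rightarrow> 'a) \<Rightarrow> 'a \<Rightarrow> 'a" where
  "adj T = (THE S. \<forall>x y. ip (T x) y = ip x (S y))"

definition closed_subspace :: "'a set \<Rightarrow> bool" where
  "closed_subspace W \<longleftrightarrow> subspace W \<and> closed W"

definition orth_proj :: "'a set \<Rightarrow> 'a \<Rightarrow> 'a" where
  "orth_proj W f = (THE p. p \<in> W \<and> (\<forall>w\<in>W. ip (f - p) w = 0))"

text \<open>The Moore--Penrose pseudo-inverse, meaningful when \<open>range K\<close> is closed.\<close>

definition pinv :: "('a \<Rightarrow> 'a) \<Rightarrow> 'a \<Rightarrow> 'a" where
  "pinv K = (THE X. bounded_op X \<and> K \<circ> X \<circ> K = K \<and> X \<circ> K \<circ> X = X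
                  \<and> adj (K \<circ> X) = K \<circ> X \<and> adj (X \<circ> K) = X \<circ> K)"

text \<open>Summability is stated separately because \<open>infsum\<close> of a non-summable family is \<open>0\<close>.\<close>

definition K_fusion_frame ::
    "('a \<Rightarrow> 'a) \<Rightarrow> 'i set \<Rightarrow> ('i \<Rightarrow> 'a set) \<Rightarrow> ('i \<Rightarrow> real) \<Rightarrow> bool" where
  "K_fusion_frame K I W v \<longleftrightarrow>
     (\<forall>i\<in>I. closed_subspace (W i)) \<and>
     (\<exists>A B. 0 < A \<and> 0 < B \<and>
       (\<forall>f. (\<lambda>i. (v i)\<^sup>2 * (norm (orth_proj (W i) f))\<^sup>2) summable_on I \<and>
            A * (norm (adj K f))\<^sup>2 \<le> (\<Sum>\<^sub>\<infinity>i\<in>I. (v i)\<^sup>2 * (norm (orth_proj (W i) f))\<^sup>2) \<and>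
            (\<Sum>\<^sub>\<infinity>i\<in>I. (v i)\<^sup>2 * (norm (orth_proj (W i) f))\<^sup>2) \<le> B * (norm f)\<^sup>2))"

end

lemma hilbert_space_real:
  "hilbert_space (scaleR :: real \<Rightarrow> 'a::{real_inner,banach} \<Rightarrow> 'a) inner"
  by standard (auto simp: conjg_real_def inner_add_left intro: inner_commute simp: power2_norm_eq_inner
      scaleR_add_right scaleR_add_left)

lemma hilbert_space_complex:
  "hilbert_space ((*) :: complex \<Rightarrow> complex \<Rightarrow> complex) (\<lambda>x y. x * cnj y)"
  by standard (auto simp: conjg_complex_def algebra_simps scaleR_conv_of_real
      complex_norm_square[symmetric] scaleR_conv_of_real)

end

theory Submission
  imports Defs
begin

text \<open>Write \<open>P\<^sub>V\<close> for orthogonal projections, \<open>K\<^sup>*\<close> for the adjoint and \<open>K\<^sup>+\<close> for the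
  Moore-Penrose inverse of \<open>K\<close>. The frame sums of the image family at \<open>f\<close> are compared with
  those of the given family at \<open>K\<^sup>* f\<close>, term by term:
  \<open>\<parallel>P\<^sub>W (K\<^sup>* f)\<parallel> \<le> \<parallel>K\<parallel> \<parallel>P\<^sub>K\<^sub>W f\<parallel>\<close> and \<open>\<parallel>P\<^sub>K\<^sub>W f\<parallel> \<le> \<parallel>K\<^sup>+\<parallel> \<parallel>P\<^sub>W (K\<^sup>* f)\<parallel>\<close>.
  Both come from \<open>\<langle>K w, f\<rangle> = \<langle>w, K\<^sup>* f\<rangle>\<close> for \<open>w \<in> W\<close>: for the first, take \<open>w = P\<^sub>W (K\<^sup>* f)\<close>
  (\<open>norm_orth_proj_adj_le\<close>); for the second, take \<open>w = K\<^sup>+ p\<close> with \<open>p = P\<^sub>K\<^sub>W f\<close>, which lies in \<open>W\<close> by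
  hypothesis and satisfies \<open>K w = p\<close> (\<open>norm_orth_proj_image_le\<close>). The second estimate turns the
  upper frame bound at \<open>K\<^sup>* f\<close> into one for the image family at \<open>f\<close>. The first does the same
  with the lower bound, which then reads \<open>A \<parallel>K\<^sup>* K\<^sup>* f\<parallel>\<^sup>2\<close>; here \<open>K\<^sup>* K\<^sup>* = K\<^sup>*\<close> because \<open>K\<close> is
  idempotent.

  The Hilbert space theory underneath (nearest points, orthogonal projections, Riesz representation
  and adjoints) is developed uniformly for real and complex scalars. For idempotent \<open>K\<close> the
  Moore-Penrose inverse is an explicit composition of two projections
  (\<open>Penrose_inverse_idempotent\<close>), which makes its boundedness evident.\<close>

section \<open>Conjugation of scalars\<close>

lemma conjg_of_real: "conjg (of_real r :: 'k::rc_field) = of_real r"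
proof (cases "r = 0")
  case True
  have "conjg (0 + 0 :: 'k) = conjg 0 + conjg 0" by (rule conjg_add)
  then show ?thesis using True by simp
next
  case False
  have "of_real r * conjg (of_real r :: 'k) = of_real r * of_real r"
    unfolding mult_conjg by (simp add: power2_eq_square scaleR_conv_of_real flip: of_real_mult)
  then show ?thesis using False by simp
qed

lemma mult_conjg_of_real: "x * conjg x = of_real ((norm (x :: 'k::rc_field))\<^sup>2)"
  unfolding mult_conjg by (simp add: scaleR_conv_of_real)

lemma norm_conjg: "norm (conjg x) = norm (x :: 'k::rc_field)"
proof (cases "x = 0")
  case True
  then show ?thesis using conjg_of_real[of 0, where 'k='k] by simp
next
  case False
  have "norm x * norm (conjg x) = norm x * norm x"
    unfolding norm_mult[symmetric] mult_conjg_of_real by (simp add: power2_eq_square norm_mult)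
  then show ?thesis using False by simp
qed

lemma conjg_conjg: "conjg (conjg x) = (x :: 'k::rc_field)"
proof (cases "x = 0")
  case True
  then show ?thesis using conjg_of_real[of 0, where 'k='k] by simp
next
  case False
  have "conjg x \<noteq> 0" using False norm_conjg[of x] by force
  moreover have "conjg x * conjg (conjg x) = conjg x * x"
    by (simp add: mult_conjg_of_real norm_conjg mult.commute[of "conjg x" x])
  ultimately show ?thesis by simp
qed

text \<open>This extracts a norm bound from an estimate of \<open>\<parallel>x\<parallel>\<^sup>2 = \<langle>x, x\<rangle>\<close> that still has
  a factor \<open>\<parallel>x\<parallel>\<close> on the right, without a case distinction on \<open>x = 0\<close>.\<close>

lemma le_of_sq_le_mult:
  fixes a b :: real
  assumes "a\<^sup>2 \<le> b * a" "0 \<le> b"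
  shows "a \<le> b"
proof (rule ccontr)
  assume "\<not> a \<le> b"
  then have "b * a < a * a" using assms(2) by (intro mult_strict_right_mono) auto
  then show False using assms(1) by (simp add: power2_eq_square)
qed

context hilbert_space
begin

section \<open>Elementary geometry of the inner product\<close>

lemma ip_zero_left: "ip 0 y = 0"
  using ip_add_left[of 0 0 y] by simp

lemma ip_minus_left: "ip (- x) y = - ip x y"
  using ip_add_left[of x "- x" y] by (simp add: ip_zero_left eq_neg_iff_add_eq_0 add.commute)

lemma ip_diff_left: "ip (x - y) z = ip x z - ip y z"
  using ip_add_left[of x "- y" z] by (simp add: ip_minus_left)

lemma ip_add_right: "ip x (y + z) = ip x y + ip x z"
  by (metis ip_add_left ip_commute conjg_add)

lemma ip_scale_right: "ip x (scale c y) = conjg c * ip x y"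
  by (metis ip_scale_left ip_commute conjg_mult)

lemma ip_zero_right: "ip x 0 = 0"
  using ip_add_right[of x 0 0] by simp

lemma ip_minus_right: "ip x (- y) = - ip x y"
  using ip_add_right[of x y "- y"] by (simp add: ip_zero_right eq_neg_iff_add_eq_0 add.commute)

lemma ip_diff_right: "ip x (y - z) = ip x y - ip x z"
  using ip_add_right[of x y "- z"] by (simp add: ip_minus_right)

lemma ip_eq_0_sym: "ip x y = 0 \<longleftrightarrow> ip y x = 0"
  using norm_conjg[of "ip x y"] ip_commute[of y x] by (metis norm_eq_zero)

lemma norm_ip_commute: "norm (ip x y) = norm (ip y x)"
  by (metis ip_commute norm_conjg)

lemma ip_self_eq_0: "ip x x = 0 \<longleftrightarrow> x = 0"
  by (simp add: ip_self)

lemma norm_ip_self: "norm (ip x x) = (norm x)\<^sup>2"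
  by (simp only: ip_self norm_of_real abs_power2)

lemma eq_if_ip_right_eq:
  assumes "\<And>z. ip z x = ip z y"
  shows "x = y"
  using assms[of "x - y"] ip_self_eq_0[of "x - y"] by (simp add: ip_diff_right)

lemma parallelogram:
  fixes x y :: 'a
  shows "(norm (x + y))\<^sup>2 + (norm (x - y))\<^sup>2 = 2 * (norm x)\<^sup>2 + 2 * (norm y)\<^sup>2"
proof -
  have "ip (x + y) (x + y) + ip (x - y) (x - y) = 2 * ip x x + 2 * ip y y"
    by (simp add: ip_add_left ip_add_right ip_diff_left ip_diff_right)
  then have "(of_real ((norm (x + y))\<^sup>2 + (norm (x - y))\<^sup>2) :: 'k)
      = of_real (2 * (norm x)\<^sup>2 + 2 * (norm y)\<^sup>2)"
    by (simp only: ip_self of_real_add of_real_mult of_real_numeral)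
  then show ?thesis unfolding of_real_eq_iff .
qed

text \<open>The distance from \<open>x\<close> to the line through \<open>y\<close>. The chosen multiple of \<open>y\<close> is
  the point of that line closest to \<open>x\<close>, so this one identity yields both Cauchy-Schwarz (the left
  side is nonnegative) and the orthogonality of a shortest connecting vector.\<close>

lemma norm_diff_line_projection:
  assumes "y \<noteq> 0"
  shows "(norm (x - scale (ip x y / of_real ((norm y)\<^sup>2)) y))\<^sup>2
    = (norm x)\<^sup>2 - (norm (ip x y))\<^sup>2 / (norm y)\<^sup>2"
proof -
  define n where "n = (norm y)\<^sup>2"
  have n: "n \<noteq> 0" using assms by (simp add: n_def)
  define c where "c = ip x y / of_real n"
  have cn: "c * of_real n = ip x y" using n by (simp add: c_def)
  have "ip (x - scale c y) (x - scale c y)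
      = ip x x - conjg c * ip x y - c * ip y x + c * (conjg c * ip y y)"
    by (simp add: ip_diff_left ip_diff_right ip_scale_left ip_scale_right algebra_simps)
  also have "c * (conjg c * ip y y) = conjg c * ip x y"
    unfolding ip_self n_def[symmetric] cn[symmetric] by (simp add: algebra_simps)
  also have "ip x x - conjg c * ip x y - c * ip y x + conjg c * ip x y = ip x x - c * ip y x"
    by simp
  also have "c * ip y x = of_real ((norm (ip x y))\<^sup>2 / n)"
    unfolding ip_commute[of y x] c_def using mult_conjg_of_real[of "ip x y"] by simp
  finally have "(of_real ((norm (x - scale c y))\<^sup>2) :: 'k)
      = of_real ((norm x)\<^sup>2 - (norm (ip x y))\<^sup>2 / n)"
    by (simp only: ip_self of_real_diff)
  then show ?thesis unfolding of_real_eq_iff c_def n_def .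
qed

lemma Cauchy_Schwarz: "norm (ip x y) \<le> norm x * norm y"
proof (cases "y = 0")
  case True
  then show ?thesis by (simp add: ip_zero_right)
next
  case False
  have "0 \<le> (norm x)\<^sup>2 - (norm (ip x y))\<^sup>2 / (norm y)\<^sup>2"
    unfolding norm_diff_line_projection[OF False, symmetric] by simp
  then have "(norm (ip x y))\<^sup>2 \<le> (norm x * norm y)\<^sup>2"
    using False by (simp add: field_simps power_mult_distrib)
  then show ?thesis by (rule power2_le_imp_le) simp
qed

lemma subspace_scaleR: "subspace W \<Longrightarrow> x \<in> W \<Longrightarrow> r *\<^sub>R x \<in> W"
  using subspace_scale[of W x "of_real r"] by (simp add: scale_of_real)

section \<open>Orthogonal projections\<close>

text \<open>A minimising sequence is Cauchy: by the parallelogram law, two almost closest points of \<open>W\<close>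
  that lie far apart would have a midpoint in \<open>W\<close> closer to \<open>f\<close> than the infimum.\<close>

lemma nearest_point_exists:
  assumes W: "closed_subspace W"
  shows "\<exists>p\<in>W. \<forall>w\<in>W. norm (f - p) \<le> norm (f - w)"
proof -
  have sW: "subspace W" and cW: "closed W" using W by (auto simp: closed_subspace_def)
  have ne: "W \<noteq> {}" using subspace_0[OF sW] by blast
  define D where "D = infdist f W"
  have D0: "0 \<le> D" by (simp add: D_def infdist_nonneg)
  have Dle: "D \<le> norm (f - w)" if "w \<in> W" for w
    using infdist_le[OF that, of f] by (simp add: D_def dist_norm)
  have "\<exists>w\<in>W. (norm (f - w))\<^sup>2 < D\<^sup>2 + 1 / real (Suc n)" for n
  proof -
    have "D < sqrt (D\<^sup>2 + 1 / real (Suc n))" by (rule real_less_rsqrt) simp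
    then obtain w where w: "w \<in> W" "dist f w < sqrt (D\<^sup>2 + 1 / real (Suc n))"
      using cInf_lessD[of "dist f ` W"] ne by (auto simp: D_def infdist_notempty)
    then have "(dist f w)\<^sup>2 < (sqrt (D\<^sup>2 + 1 / real (Suc n)))\<^sup>2"
      by (intro power_strict_mono) auto
    also have "\<dots> = D\<^sup>2 + 1 / real (Suc n)" by (rule real_sqrt_pow2) simp
    finally show ?thesis using w(1) by (auto simp: dist_norm)
  qed
  then obtain s where s: "\<And>n. s n \<in> W" "\<And>n. (norm (f - s n))\<^sup>2 < D\<^sup>2 + 1 / real (Suc n)"
    by metis
  have close: "(norm (s m - s n))\<^sup>2 < 4 / real (Suc N)" if "N \<le> m" "N \<le> n" for m n N
  proof -
    define mid where "mid = (1/2) *\<^sub>R (s m + s n)"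
    have "mid \<in> W" unfolding mid_def by (intro subspace_scaleR subspace_add sW s)
    then have "D\<^sup>2 \<le> (norm (f - mid))\<^sup>2" using Dle D0 by (intro power_mono) auto
    moreover have "(f - s m) + (f - s n) = 2 *\<^sub>R (f - mid)"
      by (simp add: mid_def scaleR_diff_right) (simp add: scaleR_2)
    then have "(norm ((f - s m) + (f - s n)))\<^sup>2 = 4 * (norm (f - mid))\<^sup>2"
      by (simp add: power_mult_distrib)
    moreover have "(norm ((f - s m) - (f - s n)))\<^sup>2 = (norm (s m - s n))\<^sup>2"
      by (simp add: norm_minus_commute)
    moreover have "1 / real (Suc m) \<le> 1 / real (Suc N)" "1 / real (Suc n) \<le> 1 / real (Suc N)"
      using that by (auto intro!: divide_left_mono)
    ultimately show ?thesis
      using parallelogram[of "f - s m" "f - s n"] s(2)[of m] s(2)[of n] by simp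
  qed
  have "Cauchy s"
  proof (rule CauchyI)
    fix e :: real assume "0 < e"
    then obtain N where "inverse (real (Suc N)) < e\<^sup>2 / 4"
      using reals_Archimedean[of "e\<^sup>2 / 4"] by auto
    then have N: "4 / real (Suc N) < e\<^sup>2" by (simp add: field_simps)
    have "norm (s m - s n) < e" if "N \<le> m" "N \<le> n" for m n
      using order.strict_trans[OF close[OF that] N] \<open>0 < e\<close>
      by (intro power2_less_imp_less[of _ e]) auto
    then show "\<exists>M. \<forall>m\<ge>M. \<forall>n\<ge>M. norm (s m - s n) < e" by blast
  qed
  then obtain p where p: "s \<longlonglongrightarrow> p" by (auto simp: Cauchy_convergent_iff convergent_def)
  have pW: "p \<in> W" using closed_sequentially[OF cW] s(1) p by blast
  have "(norm (f - p))\<^sup>2 \<le> D\<^sup>2 + 0"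
  proof (rule LIMSEQ_le)
    show "(\<lambda>n. (norm (f - s n))\<^sup>2) \<longlonglongrightarrow> (norm (f - p))\<^sup>2" by (intro tendsto_intros p)
    show "(\<lambda>n. D\<^sup>2 + 1 / real (Suc n)) \<longlonglongrightarrow> D\<^sup>2 + 0"
      by (intro tendsto_intros LIMSEQ_Suc[OF lim_inverse_n'])
    show "\<exists>N. \<forall>n\<ge>N. (norm (f - s n))\<^sup>2 \<le> D\<^sup>2 + 1 / real (Suc n)"
      using s(2) less_imp_le by blast
  qed
  then have "norm (f - p) \<le> D" using power2_le_imp_le[OF _ D0, of "norm (f - p)"] by simp
  then show ?thesis using pW Dle by (meson order_trans)
qed

lemma orth_proj_ex1:
  assumes W: "closed_subspace W"
  shows "\<exists>!p. p \<in> W \<and> (\<forall>w\<in>W. ip (f - p) w = 0)"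
proof (rule ex_ex1I)
  have sW: "subspace W" using W by (simp add: closed_subspace_def)
  obtain p where p: "p \<in> W" "\<And>w. w \<in> W \<Longrightarrow> norm (f - p) \<le> norm (f - w)"
    using nearest_point_exists[OF W, of f] by blast
  have "ip (f - p) w = 0" if w: "w \<in> W" for w
  proof (cases "w = 0")
    case True
    then show ?thesis by (simp add: ip_zero_right)
  next
    case False
    \<comment> \<open>The point \<open>p + c w\<close> is the one nearest to \<open>f\<close> on the line through \<open>p\<close> in direction \<open>w\<close>.\<close>
    define c where "c = ip (f - p) w / of_real ((norm w)\<^sup>2)"
    have "p + scale c w \<in> W" by (intro subspace_add subspace_scale sW p w)
    then have "(norm (f - p))\<^sup>2 \<le> (norm (f - p - scale c w))\<^sup>2"
      using p(2)[of "p + scale c w"] by (intro power_mono) (auto simp: algebra_simps)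
    also have "\<dots> = (norm (f - p))\<^sup>2 - (norm (ip (f - p) w))\<^sup>2 / (norm w)\<^sup>2"
      unfolding c_def by (rule norm_diff_line_projection[OF False])
    finally have "(norm (ip (f - p) w))\<^sup>2 / (norm w)\<^sup>2 \<le> 0" by simp
    then show ?thesis using False by (simp add: divide_le_0_iff)
  qed
  then show "\<exists>p. p \<in> W \<and> (\<forall>w\<in>W. ip (f - p) w = 0)" using p(1) by blast
next
  fix p q
  assume pq: "p \<in> W \<and> (\<forall>w\<in>W. ip (f - p) w = 0)" "q \<in> W \<and> (\<forall>w\<in>W. ip (f - q) w = 0)"
  have "p - q \<in> W" using pq W by (auto simp: closed_subspace_def intro: subspace_diff)
  then have "ip (f - q) (p - q) - ip (f - p) (p - q) = 0" using pq by simp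
  then have "ip (p - q) (p - q) = 0" unfolding ip_diff_left[symmetric] by simp
  then show "p = q" by (simp add: ip_self_eq_0)
qed

lemma
  assumes "closed_subspace W"
  shows orth_proj_mem: "orth_proj W f \<in> W"
    and ip_diff_orth_proj: "w \<in> W \<Longrightarrow> ip (f - orth_proj W f) w = 0"
  using theI'[OF orth_proj_ex1[OF assms, of f]] unfolding orth_proj_def[symmetric] by blast+

lemma orth_proj_eqI:
  assumes "closed_subspace W" "p \<in> W" "\<And>w. w \<in> W \<Longrightarrow> ip (f - p) w = 0"
  shows "orth_proj W f = p"
  unfolding orth_proj_def using orth_proj_ex1[OF assms(1), of f] assms(2,3)
  by (intro the1_equality) auto

lemma ip_orth_proj_left:
  assumes "closed_subspace W" "w \<in> W"
  shows "ip (orth_proj W f) w = ip f w"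
  using ip_diff_orth_proj[OF assms, of f] by (simp add: ip_diff_left)

lemma ip_orth_proj_right:
  assumes "closed_subspace W" "w \<in> W"
  shows "ip w (orth_proj W f) = ip w f"
  using ip_orth_proj_left[OF assms] by (metis ip_commute)

lemma orth_proj_selfadjoint:
  assumes "closed_subspace W"
  shows "ip (orth_proj W x) y = ip x (orth_proj W y)"
  using ip_orth_proj_left[OF assms orth_proj_mem[OF assms], of x y]
    ip_orth_proj_right[OF assms orth_proj_mem[OF assms], of x y] by simp

lemma norm_orth_proj_sq:
  assumes "closed_subspace W"
  shows "(norm (orth_proj W f))\<^sup>2 = norm (ip f (orth_proj W f))"
  using ip_orth_proj_left[OF assms orth_proj_mem[OF assms], of f f] norm_ip_self by metis

lemma norm_orth_proj_le:
  assumes "closed_subspace W"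
  shows "norm (orth_proj W f) \<le> norm f"
  by (rule le_of_sq_le_mult) (simp_all add: norm_orth_proj_sq[OF assms] Cauchy_Schwarz)

lemma orth_proj_id: "closed_subspace W \<Longrightarrow> w \<in> W \<Longrightarrow> orth_proj W w = w"
  by (rule orth_proj_eqI) (auto simp: ip_zero_left)

section \<open>Bounded operators and adjoints\<close>

lemma bounded_opI:
  assumes "\<And>x y. T (x + y) = T x + T y" "\<And>c x. T (scale c x) = scale c (T x)"
    "\<And>x. norm (T x) \<le> C * norm x"
  shows "bounded_op T"
  unfolding bounded_op_def
proof (intro conjI allI)
  show "bounded_linear T"
  proof (rule bounded_linear_intro)
    show "norm (T x) \<le> norm x * C" for x using assms(3)[of x] by (simp add: mult.commute)
    show "T (r *\<^sub>R x) = r *\<^sub>R T x" for r x unfolding scale_of_real[symmetric] by (rule assms)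
  qed (rule assms)
qed (rule assms)

lemma
  assumes "bounded_op T"
  shows bounded_op_add: "T (x + y) = T x + T y"
    and bounded_op_diff: "T (x - y) = T x - T y"
    and bounded_op_zero: "T 0 = 0"
    and bounded_op_scale: "T (scale c x) = scale c (T x)"
    and bounded_op_continuous: "continuous_on A T"
  using assms unfolding bounded_op_def
  by (auto simp: linear_add linear_diff linear_0 linear_continuous_on dest: bounded_linear.linear)

lemma bounded_op_bound:
  assumes "bounded_op T"
  obtains C where "0 < C" "\<And>x. norm (T x) \<le> C * norm x"
  using assms bounded_linear.pos_bounded[of T] unfolding bounded_op_def by (metis mult.commute)

lemma bounded_op_comp:
  assumes S: "bounded_op S" and T: "bounded_op T"
  shows "bounded_op (S \<circ> T)"
  using assms unfolding bounded_op_def by (auto simp: o_def intro: bounded_linear_compose)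

lemma bounded_op_orth_proj:
  assumes W: "closed_subspace W"
  shows "bounded_op (orth_proj W)"
proof (rule bounded_opI[of _ 1])
  have sW: "subspace W" using W by (simp add: closed_subspace_def)
  note mem = orth_proj_mem[OF W]
  show "orth_proj W (x + y) = orth_proj W x + orth_proj W y" for x y
    by (rule orth_proj_eqI[OF W])
      (simp_all add: subspace_add sW mem ip_add_left ip_diff_left ip_orth_proj_left[OF W])
  show "orth_proj W (scale c x) = scale c (orth_proj W x)" for c x
    by (rule orth_proj_eqI[OF W])
      (simp_all add: subspace_scale sW mem ip_scale_left ip_diff_left ip_orth_proj_left[OF W])
qed (simp add: norm_orth_proj_le[OF W])

text \<open>Riesz representation: a functional is determined up to a scalar by its kernel, so it is
  represented by a multiple of any nonzero vector orthogonal to the kernel.\<close>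

lemma Riesz_representation:
  assumes add: "\<And>x y. \<phi> (x + y) = \<phi> x + \<phi> y"
    and scl: "\<And>c x. \<phi> (scale c x) = c * \<phi> x"
    and bnd: "\<And>x. norm (\<phi> x) \<le> C * norm x"
  shows "\<exists>z. \<forall>x. \<phi> x = ip x z"
proof (cases "\<forall>x. \<phi> x = 0")
  case True
  then show ?thesis by (metis ip_zero_right)
next
  case False
  then obtain u where u: "\<phi> u \<noteq> 0" by blast
  define N where "N = \<phi> -` {0}"
  have bl: "bounded_linear \<phi>"
  proof (rule bounded_linear_intro)
    show "\<phi> (r *\<^sub>R x) = r *\<^sub>R \<phi> x" for r x
      using scl[of "of_real r" x] by (simp add: scale_of_real scaleR_conv_of_real)
    show "norm (\<phi> x) \<le> norm x * C" for x using bnd[of x] by (simp add: mult.commute)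
  qed (rule add)
  have phi0: "\<phi> 0 = 0" using add[of 0 0] by simp
  have phid: "\<phi> (x - y) = \<phi> x - \<phi> y" for x y
    by (rule linear_diff[OF bounded_linear.linear[OF bl]])
  have N: "closed_subspace N"
    unfolding closed_subspace_def
  proof
    show "subspace N" by (rule subspaceI) (auto simp: N_def add scl phi0)
    show "closed N" unfolding N_def
      by (intro continuous_closed_vimage) (auto intro: linear_continuous_at bl)
  qed
  define z where "z = u - orth_proj N u"
  have "\<phi> (orth_proj N u) = 0" using orth_proj_mem[OF N, of u] by (simp add: N_def)
  then have z: "\<phi> z \<noteq> 0" using u by (simp add: z_def phid)
  then have nz: "(of_real ((norm z)\<^sup>2) :: 'k) \<noteq> 0" using phi0 by auto
  have "\<phi> x = ip x (scale (conjg (\<phi> z / of_real ((norm z)\<^sup>2))) z)" for x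
  proof -
    have "x - scale (\<phi> x / \<phi> z) z \<in> N" using z by (simp add: N_def phid scl)
    then have "ip z (x - scale (\<phi> x / \<phi> z) z) = 0"
      unfolding z_def by (rule ip_diff_orth_proj[OF N])
    then have "ip (x - scale (\<phi> x / \<phi> z) z) z = 0" by (simp add: ip_eq_0_sym)
    then have "ip x z = \<phi> x / \<phi> z * of_real ((norm z)\<^sup>2)"
      by (simp add: ip_diff_left ip_scale_left ip_self)
    then show ?thesis using z nz unfolding ip_scale_right conjg_conjg by simp
  qed
  then show ?thesis by blast
qed

lemma adj_eqI:
  assumes "\<And>x y. ip (T x) y = ip x (S y)"
  shows "adj T = S"
  unfolding adj_def
proof (rule the_equality)
  fix S' assume "\<forall>x y. ip (T x) y = ip x (S' y)"
  then show "S' = S" using assms by (intro ext eq_if_ip_right_eq) metis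
qed (use assms in blast)

lemma ip_adj:
  assumes T: "bounded_op T"
  shows "ip (T x) y = ip x (adj T y)"
proof -
  obtain C where C: "\<And>x. norm (T x) \<le> C * norm x" using bounded_op_bound[OF T] by metis
  have "\<exists>z. \<forall>x. ip (T x) y = ip x z" for y
  proof (rule Riesz_representation)
    show "norm (ip (T x) y) \<le> (C * norm y) * norm x" for x
      using order_trans[OF Cauchy_Schwarz mult_right_mono[OF C norm_ge_zero]]
      by (simp add: algebra_simps)
  qed (simp_all add: bounded_op_add[OF T] bounded_op_scale[OF T] ip_add_left ip_scale_left)
  then obtain S where S: "\<And>x y. ip (T x) y = ip x (S y)" by metis
  then show ?thesis using adj_eqI[of T S] by simp
qed

lemma adj_comp:
  assumes "bounded_op S" "bounded_op T"
  shows "adj (S \<circ> T) = adj T \<circ> adj S"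
  by (rule adj_eqI) (simp add: ip_adj[OF assms(1)] ip_adj[OF assms(2)])

lemma norm_adj_le:
  assumes T: "bounded_op T" and C: "0 \<le> C" "\<And>x. norm (T x) \<le> C * norm x"
  shows "norm (adj T y) \<le> C * norm y"
proof (rule le_of_sq_le_mult)
  have "(norm (adj T y))\<^sup>2 = norm (ip (T (adj T y)) y)"
    unfolding ip_adj[OF T] norm_ip_self ..
  also have "\<dots> \<le> (C * norm (adj T y)) * norm y"
    using order_trans[OF Cauchy_Schwarz mult_right_mono[OF C(2) norm_ge_zero]] .
  finally show "(norm (adj T y))\<^sup>2 \<le> C * norm y * norm (adj T y)" by (simp add: algebra_simps)
qed (use C in simp)

section \<open>The Moore-Penrose inverse of an idempotent\<close>

text \<open>The description by which \<open>pinv\<close> selects its value, named so that existence and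
  uniqueness can be stated separately.\<close>

definition Penrose_inverse :: "('a \<Rightarrow> 'a) \<Rightarrow> ('a \<Rightarrow> 'a) \<Rightarrow> bool" where
  "Penrose_inverse K X \<longleftrightarrow> bounded_op X \<and> K \<circ> X \<circ> K = K \<and> X \<circ> K \<circ> X = X
     \<and> adj (K \<circ> X) = K \<circ> X \<and> adj (X \<circ> K) = X \<circ> K"

text \<open>For two Penrose inverses \<open>X\<close> and \<open>Y\<close>, the self-adjoint idempotents \<open>K X\<close> and \<open>K Y\<close> absorb
  each other, so taking adjoints of \<open>K Y K X = K X\<close> gives \<open>K X = K X K Y = K Y\<close>; likewise
  \<open>X K = Y K\<close>.\<close>

lemma Penrose_inverse_unique:
  assumes K: "bounded_op K" and X: "Penrose_inverse K X" and Y: "Penrose_inverse K Y"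
  shows "X = Y"
proof -
  note X = X[unfolded Penrose_inverse_def] and Y = Y[unfolded Penrose_inverse_def]
  have b: "bounded_op (K \<circ> X)" "bounded_op (K \<circ> Y)" "bounded_op (X \<circ> K)" "bounded_op (Y \<circ> K)"
    using K X Y by (auto intro: bounded_op_comp)
  have "K \<circ> X = (K \<circ> Y) \<circ> (K \<circ> X)" using Y by (metis comp_assoc)
  then have "adj (K \<circ> X) = adj (K \<circ> X) \<circ> adj (K \<circ> Y)" using adj_comp[OF b(2) b(1)] by simp
  then have "K \<circ> X = (K \<circ> X) \<circ> (K \<circ> Y)" using X Y by simp
  then have KX: "K \<circ> X = K \<circ> Y" using X by (metis comp_assoc)
  have "X \<circ> K = (X \<circ> K) \<circ> (Y \<circ> K)" using Y by (metis comp_assoc)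
  then have "adj (X \<circ> K) = adj (Y \<circ> K) \<circ> adj (X \<circ> K)" using adj_comp[OF b(3) b(4)] by simp
  then have "X \<circ> K = (Y \<circ> K) \<circ> (X \<circ> K)" using X Y by simp
  then have XK: "X \<circ> K = Y \<circ> K" using X by (metis comp_assoc)
  have "X = X \<circ> (K \<circ> X)" using X by (simp add: comp_assoc)
  also have "\<dots> = Y \<circ> K \<circ> Y" using KX XK by (metis comp_assoc)
  finally show ?thesis using Y by simp
qed

lemma pinv_eqI:
  assumes "bounded_op K" "Penrose_inverse K X"
  shows "pinv K = X"
  unfolding pinv_def Penrose_inverse_def[symmetric]
  using assms(2) Penrose_inverse_unique[OF assms(1) _ assms(2)] by (rule the_equality)

text \<open>For an idempotent, the Moore-Penrose inverse is explicit: project onto the range, then onto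
  the orthogonal complement of the kernel. Every vector differs from its image under \<open>K\<close> by a
  kernel element, so composing with \<open>K\<close> on either side leaves just one of the two
  projections.\<close>

lemma Penrose_inverse_idempotent:
  assumes K: "bounded_op K" and idem: "K \<circ> K = K"
  shows "Penrose_inverse K ((\<lambda>x. x - orth_proj (K -` {0}) x) \<circ> orth_proj (range K))"
proof -
  define N where "N = K -` {0}"
  define R where "R = range K"
  define Q where "Q x = x - orth_proj N x" for x
  define P where "P = orth_proj R"
  have KK: "K (K x) = K x" for x using fun_cong[OF idem, of x] by simp
  have N: "closed_subspace N" unfolding closed_subspace_def
  proof
    show "subspace N"
      by (rule subspaceI)
        (auto simp: N_def bounded_op_add[OF K] bounded_op_scale[OF K] bounded_op_zero[OF K])
    show "closed N" unfolding N_def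
      by (intro closed_vimage closed_singleton bounded_op_continuous[OF K])
  qed
  have R_eq: "R = {x. K x = x}" unfolding R_def using KK by (auto intro: sym)
  have R: "closed_subspace R" unfolding closed_subspace_def
  proof
    show "subspace R" unfolding R_eq
      by (rule subspaceI)
        (auto simp: bounded_op_add[OF K] bounded_op_scale[OF K] bounded_op_zero[OF K])
    show "closed R" unfolding R_eq
      by (intro closed_Collect_eq bounded_op_continuous[OF K] continuous_on_id)
  qed
  have "bounded_op (orth_proj N)" by (rule bounded_op_orth_proj[OF N])
  note PN = bounded_op_add[OF this] bounded_op_diff[OF this] bounded_op_scale[OF this]
  have bQ: "bounded_op Q"
  proof (rule bounded_opI[of _ 2])
    show "norm (Q x) \<le> 2 * norm x" for x
      unfolding Q_def using norm_triangle_ineq4[of x "orth_proj N x"] norm_orth_proj_le[OF N, of x]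
      by linarith
  qed (simp_all add: Q_def PN scale_right_diff_distrib)
  have bP: "bounded_op P" unfolding P_def by (rule bounded_op_orth_proj[OF R])
  have KP: "K (P x) = P x" for x using orth_proj_mem[OF R, of x] by (simp add: P_def R_eq)
  have PK: "P (K x) = K x" for x unfolding P_def by (rule orth_proj_id[OF R]) (simp add: R_def)
  have "K (orth_proj N x) = 0" for x using orth_proj_mem[OF N, of x] by (simp add: N_def)
  then have KQ: "K (Q x) = K x" for x by (simp add: Q_def bounded_op_diff[OF K])
  have QK: "Q (K x) = Q x" for x
  proof -
    have "K x - x \<in> N" by (simp add: N_def bounded_op_diff[OF K] KK)
    then have "Q (K x - x) = 0" unfolding Q_def by (simp add: orth_proj_id[OF N])
    then show ?thesis by (simp add: bounded_op_diff[OF bQ])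
  qed
  have QQ: "Q (Q x) = Q x" for x using QK KQ by metis
  have KX: "K \<circ> (Q \<circ> P) = P" by (simp add: fun_eq_iff KQ KP)
  have adjP: "adj P = P"
    unfolding P_def by (rule adj_eqI) (rule orth_proj_selfadjoint[OF R])
  have XK: "(Q \<circ> P) \<circ> K = Q" by (simp add: fun_eq_iff PK QK)
  have adjQ: "adj Q = Q"
    by (rule adj_eqI) (simp add: Q_def ip_diff_left ip_diff_right orth_proj_selfadjoint[OF N])
  have "Penrose_inverse K (Q \<circ> P)"
    unfolding Penrose_inverse_def KX XK
    using bounded_op_comp[OF bQ bP] adjP adjQ by (simp add: fun_eq_iff PK QQ)
  then show ?thesis by (simp add: Q_def[abs_def] P_def N_def R_def)
qed

lemma
  assumes K: "bounded_op K" and idem: "K \<circ> K = K"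
  shows bounded_op_pinv_idempotent: "bounded_op (pinv K)"
    and pinv_idempotent_right_inverse: "y \<in> range K \<Longrightarrow> K (pinv K y) = y"
proof -
  have "Penrose_inverse K (pinv K)"
    using pinv_eqI[OF K] Penrose_inverse_idempotent[OF K idem] by metis
  then have "bounded_op (pinv K)" and KXK: "K \<circ> pinv K \<circ> K = K"
    by (auto simp: Penrose_inverse_def)
  then show "bounded_op (pinv K)" by simp
  show "K (pinv K y) = y" if "y \<in> range K" using that fun_cong[OF KXK] by auto
qed

section \<open>Fusion frames under an idempotent\<close>

text \<open>With \<open>q = P\<^sub>V (T\<^sup>* f)\<close>, the square of the norm of \<open>q\<close> is \<open>\<langle>T\<^sup>* f, q\<rangle> = \<langle>f, T q\<rangle>\<close>, and as \<open>T q\<close> lies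
  in \<open>T V\<close>, only the projection of \<open>f\<close> onto \<open>T V\<close> contributes.\<close>

lemma norm_orth_proj_adj_le:
  assumes T: "bounded_op T" and C: "0 \<le> C" "\<And>x. norm (T x) \<le> C * norm x"
    and V: "closed_subspace V" and TV: "closed_subspace (T ` V)"
  shows "norm (orth_proj V (adj T f)) \<le> C * norm (orth_proj (T ` V) f)"
proof (rule le_of_sq_le_mult)
  let ?q = "orth_proj V (adj T f)"
  let ?p = "orth_proj (T ` V) f"
  have Tq: "T ?q \<in> T ` V" using orth_proj_mem[OF V] by blast
  have "(norm ?q)\<^sup>2 = norm (ip (adj T f) ?q)" by (rule norm_orth_proj_sq[OF V])
  also have "\<dots> = norm (ip (T ?q) f)" unfolding ip_adj[OF T] by (rule norm_ip_commute)
  also have "\<dots> = norm (ip (T ?q) ?p)" by (simp add: ip_orth_proj_right[OF TV Tq])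
  also have "\<dots> \<le> (C * norm ?q) * norm ?p"
    using order_trans[OF Cauchy_Schwarz mult_right_mono[OF C(2) norm_ge_zero]] .
  finally show "(norm ?q)\<^sup>2 \<le> C * norm ?p * norm ?q" by (simp add: algebra_simps)
qed (use C in simp)

text \<open>A converse estimate needs preimages in \<open>V\<close> of controlled norm: if \<open>T x\<close> is the projection of
  \<open>f\<close> onto \<open>T V\<close>, then its squared norm is \<open>\<langle>f, T x\<rangle> = \<langle>T\<^sup>* f, x\<rangle>\<close>, and as \<open>x\<close> lies in \<open>V\<close>, only the
  projection of \<open>T\<^sup>* f\<close> onto \<open>V\<close> contributes.\<close>

lemma norm_orth_proj_image_le:
  assumes T: "bounded_op T" and C: "0 \<le> C"
    and lift: "\<And>y. y \<in> T ` V \<Longrightarrow> \<exists>x\<in>V. T x = y \<and> norm x \<le> C * norm y"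
    and V: "closed_subspace V" and TV: "closed_subspace (T ` V)"
  shows "norm (orth_proj (T ` V) f) \<le> C * norm (orth_proj V (adj T f))"
proof (rule le_of_sq_le_mult)
  let ?q = "orth_proj V (adj T f)"
  let ?p = "orth_proj (T ` V) f"
  obtain x where x: "x \<in> V" "T x = ?p" "norm x \<le> C * norm ?p"
    using lift[OF orth_proj_mem[OF TV]] by blast
  have "(norm ?p)\<^sup>2 = norm (ip f ?p)" by (rule norm_orth_proj_sq[OF TV])
  also have "\<dots> = norm (ip x (adj T f))"
    unfolding x(2)[symmetric] ip_adj[OF T, symmetric] by (rule norm_ip_commute)
  also have "\<dots> = norm (ip x ?q)" by (simp add: ip_orth_proj_right[OF V x(1)])
  also have "\<dots> \<le> (C * norm ?p) * norm ?q"
    using order_trans[OF Cauchy_Schwarz mult_right_mono[OF x(3) norm_ge_zero]] .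
  finally show "(norm ?p)\<^sup>2 \<le> C * norm ?q * norm ?p" by (simp add: algebra_simps)
qed (use C in simp)


text \<open>The frame sum of the image family at \<open>f\<close> and that of the given family at \<open>K\<^sup>* f\<close> dominate each
  other termwise up to the factors \<open>C\<^sup>2\<close> and \<open>D\<^sup>2\<close>. The given lower bound, evaluated at \<open>K\<^sup>* f\<close>,
  involves \<open>K\<^sup>* K\<^sup>* f\<close>; this is where the idempotence of \<open>K\<close> enters.\<close>

lemma K_fusion_frame_image_idempotent:
  assumes K: "bounded_op K" and idem: "K \<circ> K = K"
    and frame: "K_fusion_frame K I W v"
    and closed_image: "\<And>i. i \<in> I \<Longrightarrow> closed_subspace (K ` W i)"
    and D: "0 < D"
    and lift: "\<And>i y. i \<in> I \<Longrightarrow> y \<in> K ` W i \<Longrightarrow> \<exists>x\<in>W i. K x = y \<and> norm x \<le> D * norm y"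
  shows "K_fusion_frame K I (\<lambda>i. K ` W i) v"
proof -
  obtain C where C: "0 < C" "\<And>x. norm (K x) \<le> C * norm x" using bounded_op_bound[OF K] by blast
  have W: "closed_subspace (W i)" if "i \<in> I" for i
    using frame that by (simp add: K_fusion_frame_def)
  define a where "a f i = (v i)\<^sup>2 * (norm (orth_proj (W i) (adj K f)))\<^sup>2" for f i
  define b where "b f i = (v i)\<^sup>2 * (norm (orth_proj (K ` W i) f))\<^sup>2" for f i
  obtain A B where AB: "0 < A" "0 < B" and bounds:
    "\<forall>f. (\<lambda>i. (v i)\<^sup>2 * (norm (orth_proj (W i) f))\<^sup>2) summable_on I \<and>
      A * (norm (adj K f))\<^sup>2 \<le> (\<Sum>\<^sub>\<infinity>i\<in>I. (v i)\<^sup>2 * (norm (orth_proj (W i) f))\<^sup>2) \<and>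
      (\<Sum>\<^sub>\<infinity>i\<in>I. (v i)\<^sup>2 * (norm (orth_proj (W i) f))\<^sup>2) \<le> B * (norm f)\<^sup>2"
    using frame unfolding K_fusion_frame_def by blast
  have a_sum: "a f summable_on I"
    and lower: "A * (norm (adj K (adj K f)))\<^sup>2 \<le> infsum (a f) I"
    and upper: "infsum (a f) I \<le> B * (norm (adj K f))\<^sup>2" for f
    using spec[OF bounds, of "adj K f"] by (simp_all add: a_def[abs_def])
  have adj_idem: "adj K (adj K f) = adj K f" for f
    using fun_cong[OF adj_comp[OF K K], of f] by (simp add: idem)
  have a_le: "a f i \<le> C\<^sup>2 * b f i" if "i \<in> I" for f i
  proof -
    have "norm (orth_proj (W i) (adj K f)) \<le> C * norm (orth_proj (K ` W i) f)"
      using C by (intro norm_orth_proj_adj_le[OF K _ _ W[OF that] closed_image[OF that]]) auto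
    then have "(norm (orth_proj (W i) (adj K f)))\<^sup>2 \<le> (C * norm (orth_proj (K ` W i) f))\<^sup>2"
      by (rule power_mono) simp
    from mult_left_mono[OF this, of "(v i)\<^sup>2"] show ?thesis
      by (simp add: a_def b_def power_mult_distrib algebra_simps)
  qed
  have b_le: "b f i \<le> D\<^sup>2 * a f i" if "i \<in> I" for f i
  proof -
    have "norm (orth_proj (K ` W i) f) \<le> D * norm (orth_proj (W i) (adj K f))"
      using D lift[OF that]
      by (intro norm_orth_proj_image_le[OF K _ _ W[OF that] closed_image[OF that]]) auto
    then have "(norm (orth_proj (K ` W i) f))\<^sup>2 \<le> (D * norm (orth_proj (W i) (adj K f)))\<^sup>2"
      by (rule power_mono) simp
    from mult_left_mono[OF this, of "(v i)\<^sup>2"] show ?thesis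
      by (simp add: a_def b_def power_mult_distrib algebra_simps)
  qed
  have b_sum: "b f summable_on I" for f
    by (rule summable_on_comparison_test[OF summable_on_cmult_right[OF a_sum[of f], of "D\<^sup>2"]])
      (use b_le in \<open>auto simp: b_def\<close>)
  have "A / C\<^sup>2 * (norm (adj K f))\<^sup>2 \<le> infsum (b f) I" for f
  proof -
    have "A * (norm (adj K f))\<^sup>2 \<le> infsum (a f) I" using lower[of f] by (simp add: adj_idem)
    also have "\<dots> \<le> (\<Sum>\<^sub>\<infinity>i\<in>I. C\<^sup>2 * b f i)"
      by (intro infsum_mono a_sum summable_on_cmult_right b_sum a_le)
    also have "\<dots> = C\<^sup>2 * infsum (b f) I" by (intro infsum_cmult_right b_sum)
    finally show ?thesis using C(1) by (simp add: field_simps)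
  qed
  moreover have "infsum (b f) I \<le> D\<^sup>2 * B * C\<^sup>2 * (norm f)\<^sup>2" for f
  proof -
    have "norm (adj K f) \<le> C * norm f" using C by (intro norm_adj_le[OF K]) auto
    then have adj_le: "(norm (adj K f))\<^sup>2 \<le> C\<^sup>2 * (norm f)\<^sup>2"
      unfolding power_mult_distrib[symmetric] by (rule power_mono) simp
    have "infsum (b f) I \<le> (\<Sum>\<^sub>\<infinity>i\<in>I. D\<^sup>2 * a f i)"
      by (intro infsum_mono a_sum summable_on_cmult_right b_sum b_le)
    also have "\<dots> = D\<^sup>2 * infsum (a f) I" by (intro infsum_cmult_right a_sum)
    also have "\<dots> \<le> D\<^sup>2 * (B * (norm (adj K f))\<^sup>2)" by (intro mult_left_mono upper) simp
    also have "\<dots> \<le> D\<^sup>2 * (B * (C\<^sup>2 * (norm f)\<^sup>2))"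
      using AB adj_le by (intro mult_left_mono) auto
    finally show ?thesis by (simp add: algebra_simps)
  qed
  moreover have "0 < A / C\<^sup>2" "0 < D\<^sup>2 * B * C\<^sup>2" using AB C(1) D by auto
  ultimately show ?thesis
    unfolding K_fusion_frame_def b_def[symmetric] using closed_image b_sum by blast
qed

text \<open>On the range of \<open>K\<close> the pseudo-inverse is a bounded right inverse of \<open>K\<close>. Since the range is
  closed, it contains the closure of \<open>K W\<^sub>i\<close>, so the invariance hypothesis puts a preimage
  of each point of that closure in \<open>W\<^sub>i\<close>. This makes \<open>K W\<^sub>i\<close> closed and supplies
  preimages of controlled norm.\<close>

lemma K_fusion_frame_image_pinv:
  assumes K: "bounded_op K" and idem: "K \<circ> K = K" and closed_range: "closed (range K)"
    and frame: "K_fusion_frame K I W v"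
    and inv: "\<And>i. i \<in> I \<Longrightarrow> pinv K ` closure (K ` W i) \<subseteq> W i"
  shows "K_fusion_frame K I (\<lambda>i. K ` W i) v"
proof -
  obtain D where D: "0 < D" "\<And>y. norm (pinv K y) \<le> D * norm y"
    using bounded_op_bound[OF bounded_op_pinv_idempotent[OF K idem]] by blast
  have pre: "pinv K y \<in> W i \<and> K (pinv K y) = y" if "i \<in> I" "y \<in> closure (K ` W i)" for i y
  proof -
    have "closure (K ` W i) \<subseteq> range K" by (intro closure_minimal closed_range) auto
    then show ?thesis using that inv pinv_idempotent_right_inverse[OF K idem] by blast
  qed
  show ?thesis
  proof (rule K_fusion_frame_image_idempotent[OF K idem frame _ D(1)])
    fix i assume i: "i \<in> I"
    have "subspace (W i)" using frame i by (simp add: K_fusion_frame_def closed_subspace_def)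
    then have "subspace (K ` W i)"
      unfolding subspace_def
      using bounded_op_zero[OF K] bounded_op_add[OF K] bounded_op_scale[OF K]
      by (auto simp: image_iff) metis+
    moreover have "closure (K ` W i) \<subseteq> K ` W i"
    proof
      fix y assume "y \<in> closure (K ` W i)"
      with pre[OF i] show "y \<in> K ` W i" by (metis imageI)
    qed
    then have "closed (K ` W i)" using closure_subset_eq by blast
    ultimately show "closed_subspace (K ` W i)" by (simp add: closed_subspace_def)
  next
    fix i y assume "i \<in> I" "y \<in> K ` W i"
    then show "\<exists>x\<in>W i. K x = y \<and> norm x \<le> D * norm y"
      using pre[of i y] D(2)[of y] closure_subset[of "K ` W i"] by blast
  qed
qed

end

theorem theorem3p1:
  fixes scale :: "'k::rc_field \<Rightarrow> 'a::banach \<Rightarrow> 'a"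
    and ip :: "'a \<Rightarrow> 'a \<Rightarrow> 'k"
    and K :: "'a \<Rightarrow> 'a"
    and I :: "'i set"
    and W :: "'i \<Rightarrow> 'a set"
    and v :: "'i \<Rightarrow> real"
  assumes "hilbert_space scale ip"
    and "separable_space (euclidean :: 'a topology)"
    and "hilbert_space.bounded_op scale K"
    and "K \<circ> K = K"
    and "closed (range K)"
    and "countable I"
    and "hilbert_space.K_fusion_frame scale ip K I W v"
    and "\<And>i. i \<in> I \<Longrightarrow> hilbert_space.pinv scale ip K ` closure (K ` W i) \<subseteq> W i"
  shows "hilbert_space.K_fusion_frame scale ip K I (\<lambda>i. K ` W i) v"
  using hilbert_space.K_fusion_frame_image_pinv[OF assms(1,3,4,5,7,8)] .

end
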